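(* For any $a, b \in \mathbb{N}$, the reflective Ramsey number of the start-central star $S^{\mathrm{sc}}_a$ versus the complete graph $K_b$ satisfies $$R_{\mathrm{ref}}(S^{\mathrm{sc}}_a, K_b) = 1 + (a-1)(b-1).$$
   Context: $\mathbb{N}=\{1,2,3,\ldots\}$. All graphs are undirected, simple and finite, with vertex set $\{0,1,\ldots,n-1\}$ for some $n\in\mathbb{N}$; $|G|$ denotes the order of $G$. $K_n$ is the complete graph on $n$ vertices. A $k$-edge-coloring of a graph is a map from its edge set to $\{1,\ldots,k\}$. For graphs $G,H$ and a permutation group $\Gamma$ on $V(H)$, $H$ is $\Gamma$-embeddable in $G$ if there is a graph homomorphism from $H$ to $G$ of the form $\psi\circ\varphi$, where $\varphi\in\Gamma$ and $\psi\colon V(H)\to V(G)$ is an increasing injection. For graphs $H_1,\ldots,H_k$ and permutation groups $\Gamma_1,\ldots,\Gamma_k$ on their respective vertex sets, the permutational Ramsey number $R(H_1^{\Gamma_1},\ldots,H_k^{\Gamma_k})$ is the minimum $n\in\mathbb{N}$ such that for every $k$-edge-coloring of $K_n$ there is some $j$ for which $H_j$ is $\Gamma_j$-embeddable in the spanning subgraph of $K_n$ comprising the edges of color $j$. The reflective Ramsey number $R_{\mathrm{ref}}(H_1,\ldots,H_k)$ is the permutational Ramsey number in which each $\Gamma_j$ is the group generated by the reflection $x\mapsto |H_j|-1-x$ of $V(H_j)$. For $n\in\mathbb{N}$, the start-central star $S^{\mathrm{sc}}_n$ is the star graph of order $n$ in which vertex $0$ is adjacent to all the other vertices (and there are no other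 edges). *)

theory Defs
  imports "HOL-Algebra.Bij" "HOL-Algebra.Generated_Groups"
begin

text \<open>
  A graph on the vertex set \<open>{0, \<dots>, n - 1}\<close> is given by its order \<open>n\<close> and its set of edges,
  each edge being a two-element set of vertices.
\<close>

record ord_graph =
  gorder :: nat
  edges :: "nat set set"

definition verts :: "ord_graph \<Rightarrow> nat set" where
  "verts G = {..<gorder G}"

definition simple_graph :: "ord_graph \<Rightarrow> bool" where
  "simple_graph G \<longleftrightarrow> 1 \<le> gorder G \<and> edges G \<subseteq> {e. e \<subseteq> verts G \<and> card e = 2}"

definition complete_graph :: "nat \<Rightarrow> ord_graph" where
  "complete_graph n = \<lparr>gorder = n, edges = {e. e \<subseteq> {..<n} \<and> card e = 2}\<rparr>"

definition start_central_star :: "nat \<Rightarrow> ord_graph" where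
  "start_central_star n = \<lparr>gorder = n, edges = {{0, i} | i. 1 \<le> i \<and> i < n}\<rparr>"

definition graph_hom :: "ord_graph \<Rightarrow> ord_graph \<Rightarrow> (nat \<Rightarrow> nat) \<Rightarrow> bool" where
  "graph_hom H G f \<longleftrightarrow> f \<in> verts H \<rightarrow> verts G \<and> (\<forall>u v. {u, v} \<in> edges H \<longrightarrow> {f u, f v} \<in> edges G)"

text \<open>
  A permutation group on \<open>verts H\<close> is represented by the carrier set of a subgroup of
  \<open>BijGroup (verts H)\<close>.
\<close>

definition embeddable :: "ord_graph \<Rightarrow> (nat \<Rightarrow> nat) set \<Rightarrow> ord_graph \<Rightarrow> bool" where
  "embeddable H \<Gamma> G \<longleftrightarrow>
     (\<exists>\<phi>\<in>\<Gamma>. \<exists>\<psi> \<in> verts H \<rightarrow> verts G. strict_mono_on (verts H) \<psi> \<and> graph_hom H G (\<psi> \<circ> \<phi>))"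

definition edge_coloring :: "nat \<Rightarrow> ord_graph \<Rightarrow> (nat set \<Rightarrow> nat) \<Rightarrow> bool" where
  "edge_coloring k G c \<longleftrightarrow> c \<in> edges G \<rightarrow> {1..k}"

definition color_subgraph :: "ord_graph \<Rightarrow> (nat set \<Rightarrow> nat) \<Rightarrow> nat \<Rightarrow> ord_graph" where
  "color_subgraph G c j = \<lparr>gorder = gorder G, edges = {e \<in> edges G. c e = j}\<rparr>"

text \<open>
  Lists are indexed from 0 and colors from 1, so color \<open>j\<close> belongs to the list entry \<open>j - 1\<close>.
\<close>

definition perm_ramsey_property :: "(ord_graph \<times> (nat \<Rightarrow> nat) set) list \<Rightarrow> nat \<Rightarrow> bool" where
  "perm_ramsey_property Hs n \<longleftrightarrow>
     (\<forall>c. edge_coloring (length Hs) (complete_graph n) c \<longrightarrow>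
        (\<exists>j\<in>{1..length Hs}.
           embeddable (fst (Hs ! (j - 1))) (snd (Hs ! (j - 1)))
             (color_subgraph (complete_graph n) c j)))"

definition perm_ramsey :: "(ord_graph \<times> (nat \<Rightarrow> nat) set) list \<Rightarrow> nat" where
  "perm_ramsey Hs = (LEAST n. 1 \<le> n \<and> perm_ramsey_property Hs n)"

definition reflection :: "ord_graph \<Rightarrow> nat \<Rightarrow> nat" where
  "reflection H = (\<lambda>x\<in>verts H. gorder H - 1 - x)"

definition reflection_group :: "ord_graph \<Rightarrow> (nat \<Rightarrow> nat) set" where
  "reflection_group H = generate (BijGroup (verts H)) {reflection H}"

definition reflective_ramsey :: "ord_graph list \<Rightarrow> nat" where
  "reflective_ramsey Hs = perm_ramsey (map (\<lambda>H. (H, reflection_group H)) Hs)"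

lemma simple_complete_graph: "1 \<le> n \<Longrightarrow> simple_graph (complete_graph n)"
  by (simp add: simple_graph_def complete_graph_def verts_def)

lemma simple_start_central_star: "1 \<le> n \<Longrightarrow> simple_graph (start_central_star n)"
  by (auto simp: simple_graph_def start_central_star_def verts_def)

lemma reflection_in_BijGroup: "reflection H \<in> carrier (BijGroup (verts H))"
proof -
  have "bij_betw (reflection H) (verts H) (verts H)"
    by (rule bij_betw_byWitness[where f' = "reflection H"])
       (auto simp: reflection_def verts_def)
  then show ?thesis
    by (simp add: BijGroup_def Bij_def reflection_def)
qed

lemma subgroup_reflection_group: "subgroup (reflection_group H) (BijGroup (verts H))"
  unfolding reflection_group_def
  by (rule group.generate_is_subgroup[OF group_BijGroup]) (simp add: reflection_in_BijGroup)

end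

theory Submission
  imports Defs
begin

text \<open>
  Call the two colors red and blue.  A red \<open>start_central_star a\<close> is embedded as soon as some vertex
  has \<open>a - 1\<close> red neighbors above it.  If no vertex does, an independent set of the red graph is
  built greedily from below: keep the least remaining vertex and discard its red neighbors, all of
  which lie above it.  Each step uses up at most \<open>a - 1\<close> vertices, so out of
  \<open>1 + (a - 1) * (b - 1)\<close> vertices one can keep \<open>b\<close>, and they span a blue
  \<open>K\<^sub>b\<close> (\<open>ordered_greedy_independent_set\<close>, \<open>ramsey_property_star_complete\<close>).

  The bound is sharp because at most \<open>(a - 1) * (b - 1)\<close> vertices can be partitioned into \<open>b - 1\<close>
  blocks of at most \<open>a - 1\<close> vertices each.  With red inside the blocks and blue between them, a
  red star stays within one block and has at most \<open>a - 1\<close> vertices, and a blue clique meets each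
  block at most once and has at most \<open>b - 1\<close> vertices (\<open>not_ramsey_property_star_complete\<close>).

  The upper bound produces increasing homomorphisms, which are embeddings under every permutation
  group; the lower bound excludes all injective homomorphisms, whichever group they come from.  So
  both bounds are proved for arbitrary groups and then applied to the reflection groups.
\<close>

section \<open>Independent sets in graphs of small forward degree\<close>

text \<open>
  The greedy choice of a least element makes all of its neighbors forward neighbors.  Hence a bound
  on forward degrees alone yields what is usually derived from a bound on the maximum degree.
\<close>

lemma ordered_greedy_independent_set:
  fixes V :: "'a :: linorder set"
  assumes "finite V"
    and "\<And>v. v \<in> V \<Longrightarrow> card {w \<in> V. v < w \<and> E v w} < d"
    and "d * m < card V"
  shows "\<exists>S\<subseteq>V. card S = Suc m \<and> (\<forall>u\<in>S. \<forall>v\<in>S. u < v \<longrightarrow> \<not> E u v)"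
  using assms
proof (induction m arbitrary: V)
  case 0
  then obtain v where "v \<in> V"
    by fastforce
  then have "{v} \<subseteq> V \<and> card {v} = Suc 0 \<and> (\<forall>u\<in>{v}. \<forall>w\<in>{v}. u < w \<longrightarrow> \<not> E u w)"
    by simp
  then show ?case by blast
next
  case (Suc m)
  have "V \<noteq> {}"
    using Suc.prems(3) by auto
  define v where "v = Min V"
  have v: "v \<in> V" "\<And>w. w \<in> V \<Longrightarrow> v \<le> w"
    using \<open>V \<noteq> {}\<close> Suc.prems(1) by (simp_all add: v_def)
  define N where "N = {w \<in> V. v < w \<and> E v w}"
  define W where "W = V - insert v N"
  have N: "N \<subseteq> V" "v \<notin> N" "finite N"
    using Suc.prems(1) by (auto simp: N_def)
  have "card (insert v N) \<le> d"
    using Suc.prems(2)[OF v(1)] N by (simp add: N_def)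
  moreover have "card W = card V - card (insert v N)"
    unfolding W_def using v(1) N by (intro card_Diff_subset) auto
  ultimately have large: "d * m < card W"
    using Suc.prems(3) by simp
  have "W \<subseteq> V" "finite W"
    using Suc.prems(1) by (auto simp: W_def)
  have small: "card {w \<in> W. u < w \<and> E u w} < d" if "u \<in> W" for u
  proof -
    have "card {w \<in> W. u < w \<and> E u w} \<le> card {w \<in> V. u < w \<and> E u w}"
      using Suc.prems(1) \<open>W \<subseteq> V\<close> by (intro card_mono) auto
    then show ?thesis
      using Suc.prems(2)[of u] that \<open>W \<subseteq> V\<close> by auto
  qed
  from Suc.IH[OF \<open>finite W\<close> small large] obtain S where
    S: "S \<subseteq> W" "card S = Suc m" "\<forall>u\<in>S. \<forall>w\<in>S. u < w \<longrightarrow> \<not> E u w"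
    by blast
  have "v \<notin> S" "finite S"
    using S(1) \<open>finite W\<close> by (auto simp: W_def intro: finite_subset)
  then have "card (insert v S) = Suc (Suc m)"
    using S(2) by simp
  moreover have "insert v S \<subseteq> V"
    using S(1) v(1) \<open>W \<subseteq> V\<close> by blast
  moreover have "\<forall>u\<in>insert v S. \<forall>w\<in>insert v S. u < w \<longrightarrow> \<not> E u w"
    using S v by (fastforce simp: W_def N_def)
  ultimately show ?case by blast
qed

lemma increasing_enumeration_of_finite_set:
  fixes S :: "'a :: linorder set"
  assumes "finite S"
  shows "\<exists>\<psi> :: nat \<Rightarrow> 'a. strict_mono_on {..<card S} \<psi> \<and> \<psi> ` {..<card S} = S"
proof -
  let ?xs = "sorted_list_of_set S"
  have "strict_mono_on {..<card S} ((!) ?xs)"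
    using strict_sorted_list_of_set[of S]
    by (auto simp: strict_mono_on_def sorted_wrt_iff_nth_less)
  moreover have "(!) ?xs ` {..<card S} = S"
    using assms nth_image[of "card S" ?xs] by (simp add: lessThan_atLeast0)
  ultimately show ?thesis by blast
qed

section \<open>Embeddings with and without regard to the vertex order\<close>

text \<open>
  The group contains the identity, so \<open>\<psi>\<close> itself is the increasing injection required.  In \<open>BijGroup\<close>
  the identity is undefined outside the vertex set; simplicity of \<open>H\<close> confines the edges to that set.
\<close>

lemma embeddable_if_increasing_hom:
  assumes "subgroup \<Gamma> (BijGroup (verts H))" and "simple_graph H"
    and "graph_hom H G \<psi>" and "strict_mono_on (verts H) \<psi>"
  shows "embeddable H \<Gamma> G"
proof -
  have id: "(\<lambda>x\<in>verts H. x) \<in> \<Gamma>"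
    using subgroup.one_closed[OF assms(1)] by (simp add: BijGroup_def)
  have "u \<in> verts H \<and> v \<in> verts H" if "{u, v} \<in> edges H" for u v
    using assms(2) that by (auto simp: simple_graph_def)
  then have "graph_hom H G (\<psi> \<circ> (\<lambda>x\<in>verts H. x))"
    using assms(3) by (auto simp: graph_hom_def)
  moreover have "\<psi> \<in> verts H \<rightarrow> verts G"
    using assms(3) by (simp add: graph_hom_def)
  ultimately show ?thesis
    unfolding embeddable_def using id assms(4) by blast
qed

lemma embeddable_imp_injective_hom:
  assumes "subgroup \<Gamma> (BijGroup (verts H))" and "embeddable H \<Gamma> G"
  obtains f where "inj_on f (verts H)" and "graph_hom H G f"
proof -
  from assms(2) obtain \<phi> \<psi> where \<phi>: "\<phi> \<in> \<Gamma>"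
    and \<psi>: "strict_mono_on (verts H) \<psi>" and hom: "graph_hom H G (\<psi> \<circ> \<phi>)"
    unfolding embeddable_def by blast
  have "bij_betw \<phi> (verts H) (verts H)"
    using subgroup.subset[OF assms(1)] \<phi> by (auto simp: BijGroup_def Bij_def)
  then have "inj_on (\<psi> \<circ> \<phi>) (verts H)"
    using strict_mono_on_imp_inj_on[OF \<psi>] by (simp add: bij_betw_def comp_inj_on)
  with hom show thesis by (rule that[rotated])
qed

section \<open>Stars versus complete graphs\<close>

text \<open>
  Enumerate \<open>v\<close> together with \<open>a - 1\<close> of its forward neighbors in increasing order.  The center \<open>0\<close>
  goes to \<open>v\<close>, the least of these vertices, so the edges of the star go to edges at \<open>v\<close>.
\<close>

lemma start_central_star_embeddable:
  assumes "subgroup \<Gamma> (BijGroup (verts (start_central_star a)))" and "1 \<le> a"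
    and "v \<in> verts G" and "a - 1 \<le> card {w \<in> verts G. v < w \<and> {v, w} \<in> edges G}"
  shows "embeddable (start_central_star a) \<Gamma> G"
proof -
  obtain T where T: "T \<subseteq> {w \<in> verts G. v < w \<and> {v, w} \<in> edges G}" "card T = a - 1" "finite T"
    using obtain_subset_with_card_n[OF assms(4)] by blast
  let ?S = "insert v T"
  have "v \<notin> T"
    using T(1) by auto
  then have "card ?S = a"
    using T(2,3) assms(2) by simp
  then obtain \<psi> where mono: "strict_mono_on {..<a} \<psi>" and image: "\<psi> ` {..<a} = ?S"
    using increasing_enumeration_of_finite_set[of ?S] T(3) by auto
  have mem: "\<psi> j \<in> ?S" if "j < a" for j
    using imageI[of j "{..<a}" \<psi>] that by (simp only: image lessThan_iff)
  have "\<psi> 0 = v"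
  proof -
    have "v \<in> \<psi> ` {..<a}"
      by (simp add: image)
    then obtain i where i: "i < a" "\<psi> i = v"
      by auto
    have "v \<le> \<psi> 0"
      using mem[of 0] T(1) i(1) by auto
    moreover have "\<psi> 0 < \<psi> i" if "i \<noteq> 0"
      using strict_mono_onD[OF mono, of 0 i] that i(1) by simp
    ultimately show ?thesis
      using i(2) by (cases "i = 0") auto
  qed
  have leaf: "{\<psi> 0, \<psi> i} \<in> edges G" if "1 \<le> i" "i < a" for i
  proof -
    have "\<psi> 0 < \<psi> i"
      using strict_mono_onD[OF mono, of 0 i] that by simp
    then show ?thesis
      using mem[OF that(2)] T(1) \<open>\<psi> 0 = v\<close> by auto
  qed
  have "\<psi> \<in> {..<a} \<rightarrow> verts G"
    using mem T(1) assms(3) by auto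
  moreover have "{\<psi> x, \<psi> y} \<in> edges G" if "{x, y} \<in> edges (start_central_star a)" for x y
    using that leaf by (fastforce simp: start_central_star_def doubleton_eq_iff insert_commute)
  ultimately have "graph_hom (start_central_star a) G \<psi>"
    by (simp add: graph_hom_def verts_def start_central_star_def)
  with assms(1) simple_start_central_star[OF assms(2)] show ?thesis
    by (rule embeddable_if_increasing_hom) (use mono in \<open>simp add: verts_def start_central_star_def\<close>)
qed

lemma complete_graph_embeddable:
  assumes "subgroup \<Gamma> (BijGroup (verts (complete_graph b)))" and "1 \<le> b"
    and "S \<subseteq> verts G" and "card S = b"
    and clique: "\<And>u v. \<lbrakk>u \<in> S; v \<in> S; u < v\<rbrakk> \<Longrightarrow> {u, v} \<in> edges G"
  shows "embeddable (complete_graph b) \<Gamma> G"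
proof -
  have "finite S"
    using assms(2,4) card.infinite by fastforce
  then obtain \<psi> where mono: "strict_mono_on {..<b} \<psi>" and image: "\<psi> ` {..<b} = S"
    using increasing_enumeration_of_finite_set assms(4) by blast
  have pair: "{\<psi> x, \<psi> y} \<in> edges G" if "x < y" "y < b" for x y
    using clique[of "\<psi> x" "\<psi> y"] strict_mono_onD[OF mono, of x y] image that by auto
  have "{\<psi> x, \<psi> y} \<in> edges G" if "{x, y} \<in> edges (complete_graph b)" for x y
  proof -
    from that have "x < b" "y < b" "x \<noteq> y"
      by (auto simp: complete_graph_def card_2_iff)
    then show ?thesis
      using pair[of x y] pair[of y x] by (auto simp: insert_commute neq_iff)
  qed
  moreover have "\<psi> \<in> {..<b} \<rightarrow> verts G"
    using image assms(3) by blast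
  ultimately have "graph_hom (complete_graph b) G \<psi>"
    by (simp add: graph_hom_def verts_def complete_graph_def)
  with assms(1) simple_complete_graph[OF assms(2)] show ?thesis
    by (rule embeddable_if_increasing_hom) (use mono in \<open>simp add: verts_def complete_graph_def\<close>)
qed

lemma perm_ramsey_property_two_colors:
  "perm_ramsey_property [(H, \<Gamma>), (H', \<Gamma>')] n \<longleftrightarrow>
    (\<forall>c. edge_coloring 2 (complete_graph n) c \<longrightarrow>
       embeddable H \<Gamma> (color_subgraph (complete_graph n) c 1) \<or>
       embeddable H' \<Gamma>' (color_subgraph (complete_graph n) c 2))"
proof -
  have "{1..length [(H, \<Gamma>), (H', \<Gamma>')]} = {1, 2}"
    by auto
  then show ?thesis
    by (simp add: perm_ramsey_property_def numeral_2_eq_2)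
qed

lemma ramsey_property_star_complete:
  assumes "subgroup \<Gamma> (BijGroup (verts (start_central_star a)))" and "1 \<le> a"
    and "subgroup \<Gamma>' (BijGroup (verts (complete_graph b)))" and "1 \<le> b"
    and "(a - 1) * (b - 1) < n"
  shows "perm_ramsey_property [(start_central_star a, \<Gamma>), (complete_graph b, \<Gamma>')] n"
  unfolding perm_ramsey_property_two_colors
proof (intro allI impI)
  fix c
  assume c: "edge_coloring 2 (complete_graph n) c"
  let ?R = "color_subgraph (complete_graph n) c 1" and ?B = "color_subgraph (complete_graph n) c 2"
  have edge: "{u, v} \<in> edges (complete_graph n)" if "u < v" "v < n" for u v
    using that by (auto simp: complete_graph_def)
  have V: "verts ?R = {..<n}" "verts ?B = {..<n}"
    by (simp_all add: verts_def color_subgraph_def complete_graph_def)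
  have red: "{u, v} \<in> edges ?R \<longleftrightarrow> c {u, v} = 1" if "u < v" "v < n" for u v
    using edge[OF that] by (simp add: color_subgraph_def)
  have blue: "{u, v} \<in> edges ?B" if "u < v" "v < n" "{u, v} \<notin> edges ?R" for u v
  proof -
    have "c {u, v} \<in> {1..2}"
      using c edge[OF that(1,2)] unfolding edge_coloring_def by blast
    with that red[of u v] edge[of u v] show ?thesis
      by (auto simp: color_subgraph_def)
  qed
  show "embeddable (start_central_star a) \<Gamma> ?R \<or> embeddable (complete_graph b) \<Gamma>' ?B"
  proof (cases "\<exists>v\<in>verts ?R. a - 1 \<le> card {w \<in> verts ?R. v < w \<and> {v, w} \<in> edges ?R}")
    case True
    then show ?thesis
      using start_central_star_embeddable[OF assms(1,2)] by blast
  next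
    case False
    \<comment> \<open>\<open>b - 1\<close> greedy steps leave a vertex over, which is the last member of the clique\<close>
    then have "\<exists>S\<subseteq>{..<n}. card S = Suc (b - 1) \<and>
        (\<forall>u\<in>S. \<forall>v\<in>S. u < v \<longrightarrow> {u, v} \<notin> edges ?R)"
      using assms(5) unfolding V
      by (intro ordered_greedy_independent_set[where d = "a - 1"]) (simp_all add: not_le)
    then obtain S where S: "S \<subseteq> {..<n}" "card S = b"
      "\<And>u v. \<lbrakk>u \<in> S; v \<in> S; u < v\<rbrakk> \<Longrightarrow> {u, v} \<notin> edges ?R"
      using assms(4) by auto
    have "embeddable (complete_graph b) \<Gamma>' ?B"
      using assms(3,4)
    proof (rule complete_graph_embeddable)
      show "S \<subseteq> verts ?B"
        using S(1) by (simp add: V)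
      show "{u, v} \<in> edges ?B" if "u \<in> S" "v \<in> S" "u < v" for u v
        using S(1) S(3)[OF that] that by (intro blue) auto
    qed (rule S(2))
    then show ?thesis ..
  qed
qed

text \<open>
  The blocks are the intervals of length \<open>a - 1\<close>, so two vertices share a block when they have the
  same quotient on division by \<open>a - 1\<close>.
\<close>

lemma not_ramsey_property_star_complete:
  assumes "subgroup \<Gamma> (BijGroup (verts (start_central_star a)))"
    and "subgroup \<Gamma>' (BijGroup (verts (complete_graph b)))"
    and "1 \<le> n" and "n \<le> (a - 1) * (b - 1)"
  shows "\<not> perm_ramsey_property [(start_central_star a, \<Gamma>), (complete_graph b, \<Gamma>')] n"
proof -
  define d where "d = a - 1"
  have "(a - 1) * (b - 1) \<noteq> 0"
    using assms(3,4) by linarith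
  then have pos: "0 < d" "a = Suc d" "1 < b"
    by (auto simp: d_def)
  define c :: "nat set \<Rightarrow> nat" where "c e = (if \<exists>q. \<forall>x\<in>e. x div d = q then 1 else 2)" for e
  have c: "c {u, v} = (if u div d = v div d then 1 else 2)" for u v
    by (auto simp: c_def)
  let ?R = "color_subgraph (complete_graph n) c 1" and ?B = "color_subgraph (complete_graph n) c 2"
  have "\<not> embeddable (start_central_star a) \<Gamma> ?R"
  proof
    assume "embeddable (start_central_star a) \<Gamma> ?R"
    with assms(1) obtain f where inj: "inj_on f (verts (start_central_star a))"
      and hom: "graph_hom (start_central_star a) ?R f"
      by (rule embeddable_imp_injective_hom)
    let ?q = "f 0 div d"
    have "f i div d = ?q" if "i < a" for i
    proof (cases "i = 0")
      case False
      with that have "{0, i} \<in> edges (start_central_star a)"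
        by (auto simp: start_central_star_def)
      then have "{f 0, f i} \<in> edges ?R"
        using hom unfolding graph_hom_def by blast
      then have "c {f 0, f i} = 1"
        by (simp add: color_subgraph_def)
      then show ?thesis
        by (simp add: c split: if_splits)
    qed simp
    then have "f i \<in> {?q * d..<?q * d + d}" if "i < a" for i
    proof -
      have "f i = ?q * d + f i mod d"
        using div_mult_mod_eq[of "f i" d] \<open>\<And>i. i < a \<Longrightarrow> f i div d = ?q\<close>[OF that] by metis
      moreover have "f i mod d < d"
        using pos(1) by simp
      ultimately show ?thesis
        unfolding atLeastLessThan_iff by linarith
    qed
    then have "f ` {..<a} \<subseteq> {?q * d..<?q * d + d}"
      by blast
    then have "card (f ` {..<a}) \<le> d"
      using card_mono[of "{?q * d..<?q * d + d}"] by fastforce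
    then show False
      using inj pos(2) by (simp add: card_image verts_def start_central_star_def)
  qed
  moreover have "\<not> embeddable (complete_graph b) \<Gamma>' ?B"
  proof
    assume "embeddable (complete_graph b) \<Gamma>' ?B"
    with assms(2) obtain f where inj: "inj_on f (verts (complete_graph b))"
      and hom: "graph_hom (complete_graph b) ?B f"
      by (rule embeddable_imp_injective_hom)
    let ?q = "\<lambda>i. f i div d"
    have "inj_on ?q {..<b}"
    proof (rule inj_onI, rule ccontr)
      fix i j
      assume ij: "i \<in> {..<b}" "j \<in> {..<b}" "?q i = ?q j" "i \<noteq> j"
      then have "{i, j} \<in> edges (complete_graph b)"
        by (simp add: complete_graph_def)
      then have "{f i, f j} \<in> edges ?B"
        using hom unfolding graph_hom_def by blast
      then have "c {f i, f j} = 2"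
        by (simp add: color_subgraph_def)
      then show False
        using ij(3) by (simp add: c)
    qed
    moreover have "?q i < b - 1" if "i < b" for i
    proof -
      have "f i < n"
        using hom that
        by (auto simp: graph_hom_def verts_def color_subgraph_def complete_graph_def)
      then have "f i < (b - 1) * d"
        using assms(4) by (simp add: d_def mult.commute)
      then show ?thesis
        using pos(1) by (simp add: div_less_iff_less_mult)
    qed
    then have "?q ` {..<b} \<subseteq> {..<b - 1}"
      by auto
    ultimately have "b \<le> b - 1"
      using card_inj_on_le[of ?q "{..<b}" "{..<b - 1}"] by simp
    then show False
      using pos(3) by simp
  qed
  moreover have "edge_coloring 2 (complete_graph n) c"
    by (auto simp: edge_coloring_def c_def)
  ultimately show ?thesis
    unfolding perm_ramsey_property_two_colors by blast
qed

theorem corollary4p16: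
  fixes a b :: nat
  assumes "1 \<le> a" and "1 \<le> b"
  shows "reflective_ramsey [start_central_star a, complete_graph b] = 1 + (a - 1) * (b - 1)"
  unfolding reflective_ramsey_def perm_ramsey_def list.map
proof (rule Least_equality)
  show "1 \<le> 1 + (a - 1) * (b - 1) \<and> perm_ramsey_property
      [(start_central_star a, reflection_group (start_central_star a)),
       (complete_graph b, reflection_group (complete_graph b))] (1 + (a - 1) * (b - 1))"
    using ramsey_property_star_complete[OF subgroup_reflection_group assms(1)
        subgroup_reflection_group assms(2)] by simp
next
  fix n
  assume "1 \<le> n \<and> perm_ramsey_property
      [(start_central_star a, reflection_group (start_central_star a)),
       (complete_graph b, reflection_group (complete_graph b))] n"
  then show "1 + (a - 1) * (b - 1) \<le> n"
    using not_ramsey_property_star_complete[OF subgroup_reflection_group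
        subgroup_reflection_group, of n a b] by linarith
qed

end
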